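(* Let $a,b\in\mathbb N$ and let $n$ be a positive integer. For each $a'\in\{a,a-1\}$, $$\sum_{k=0}^{n-1}(-1)^{a'k}q^{a'k(k+1)/2-k}[2k+1]_q\begin{bmatrix}n-1\\k\end{bmatrix}_q^a\begin{bmatrix}n+k\\k\end{bmatrix}_q^b\equiv0\pmod{[n]_q}$$ (in the Laurent polynomial ring $\mathbb Z[q,q^{-1}]$). Consequently, for either choice of sign, $$\sum_{k=0}^{n-1}(\pm1)^k(2k+1)\binom{n-1}k^a\binom{n+k}k^b\equiv0\pmod n.$$
   Context: $[m]_q=(1-q^m)/(1-q)$ for $m\in\mathbb Z$; $\begin{bmatrix}m\\0\end{bmatrix}_q=1$ and $\begin{bmatrix}m\\k\end{bmatrix}_q=\prod_{j=0}^{k-1}[m-j]_q/\prod_{j=1}^k[j]_q$ for $k\ge1$. *)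

theory Defs
  imports Complex_Main "HOL-Computational_Algebra.Computational_Algebra" "HOL-Number_Theory.Cong"
begin

text \<open>All $q$-analogues live in the field of fractions of $\mathbb Z[X]$, in which $q$ is
  the image of the indeterminate.\<close>

definition qvar :: "int poly fract" where
  "qvar = to_fract [:0, 1:]"

definition qint :: "int \<Rightarrow> int poly fract" where
  "qint m = (1 - qvar powi m) / (1 - qvar)"

definition qbinom :: "int \<Rightarrow> nat \<Rightarrow> int poly fract" where
  "qbinom m k = (\<Prod>j<k. qint (m - int j)) / (\<Prod>j=1..k. qint (int j))"

text \<open>The Laurent polynomial ring $\mathbb Z[q,q^{-1}]$ inside this field.\<close>

definition laurent_polys :: "int poly fract set" where
  "laurent_polys = {to_fract p * qvar powi i | (p :: int poly) (i :: int). True}"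

text \<open>Congruence in $\mathbb Z[q,q^{-1}]$: the cofactor must itself be a Laurent polynomial
  (divisibility in the surrounding field would be vacuous).\<close>

definition laurent_cong :: "int poly fract \<Rightarrow> int poly fract \<Rightarrow> int poly fract \<Rightarrow> bool" where
  "laurent_cong x y m \<longleftrightarrow>
     x \<in> laurent_polys \<and> y \<in> laurent_polys \<and> m \<in> laurent_polys \<and>
     (\<exists>z \<in> laurent_polys. x - y = m * z)"

end

theory Submission
  imports Defs
begin

text \<open>Since $[n]_q$ is monic with simple roots $z^n = 1$, $z \<noteq> 1$, it suffices that the sum vanishes
  at every such $z$. There, with $A_k$ and $B_k$ the two $q$-binomials, the factor
  $c_k = ((-1)^k z^{k(k+1)/2} A_k)^a B_k^b$ satisfies $c_{k+1} = c_k$ unless $z^{k+1} = 1$. What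
  remains of the summand, up to powers of $1 - z$, is a difference $V_{k+1} - V_k$ with $V_k = 0$
  whenever $z^k = 1$, so the weighted sum still telescopes, to $c_{n-1} V_n = 0$. The integer
  congruence is the value at $q = 1$, the two choices of $a'$ giving the two signs.\<close>

section \<open>Gaussian binomials without division\<close>

text \<open>The product quotient can read 0/0 at a root of unity. The Pascal recursion makes sense
  in every commutative ring and commutes with ring homomorphisms.\<close>

fun gauss_binom :: "'a::comm_ring_1 \<Rightarrow> nat \<Rightarrow> nat \<Rightarrow> 'a" where
  "gauss_binom q n 0 = 1"
| "gauss_binom q 0 (Suc k) = 0"
| "gauss_binom q (Suc n) (Suc k) = gauss_binom q n k + q ^ Suc k * gauss_binom q n (Suc k)"

text \<open>Pascal's rule combines the induction hypotheses for \<open>j\<close> and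
  \<open>Suc j\<close>. Everything stays multiplied out, since 1 - q^(k+1) may be zero or a zero
  divisor.\<close>

lemma gauss_binom_absorb:
  "(1 - q ^ Suc k) * gauss_binom q (Suc n) (Suc k) = (1 - q ^ Suc n) * gauss_binom q n k"
proof (induction n arbitrary: k)
  case 0
  then show ?case by (cases k) (simp_all add: algebra_simps)
next
  case (Suc n)
  show ?case
  proof (cases k)
    case 0
    then show ?thesis
      using arg_cong[OF Suc.IH[of 0], of "(*) q"] by (simp add: algebra_simps)
  next
    case k: (Suc j)
    define x where "x = q ^ Suc j"
    define y where "y = q ^ Suc n"
    define G0 G1 G G' where
      "G0 = gauss_binom q n j" and "G1 = gauss_binom q n (Suc j)"
      and "G = gauss_binom q (Suc n) (Suc j)" and "G' = gauss_binom q (Suc n) (Suc (Suc j))"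
    have G: "G = G0 + x * G1"
      by (simp add: G_def G0_def G1_def x_def)
    have e1: "(1 - x) * G = (1 - y) * G0"
      using Suc.IH[of j] by (simp add: G_def G0_def x_def y_def)
    have e2: "(1 - q * x) * G' = (1 - y) * G1"
      using Suc.IH[of "Suc j"] by (simp add: G'_def G1_def x_def y_def)
    have "(1 - q * x) * (G + q * x * G') = (1 - q * x) * G + q * x * ((1 - y) * G1)"
      by (simp only: e2[symmetric] distrib_left) (simp only: mult_ac)
    also have "x * ((1 - y) * G1) = (1 - y) * G - (1 - x) * G"
      by (simp only: e1) (simp add: G algebra_simps)
    then have "(1 - q * x) * G + q * x * ((1 - y) * G1)
        = (1 - q * x) * G + q * ((1 - y) * G - (1 - x) * G)"
      by (simp add: mult.assoc)
    also have "\<dots> = (1 - q * y) * G"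
      by (simp add: algebra_simps)
    finally show ?thesis
      by (simp add: k G_def G'_def x_def y_def mult.assoc)
  qed
qed

text \<open>Relates neighbours in one row; the extra factor q^(k+1) avoids the exponent n - k. If
  q^(n+1) = 1, the right factor becomes -(1 - q^(k+1)), the source of the alternating sign.\<close>

lemma gauss_binom_step:
  "q ^ Suc k * ((1 - q ^ Suc k) * gauss_binom q n (Suc k))
     = (q ^ Suc k - q ^ Suc n) * gauss_binom q n k"
  using gauss_binom_absorb[of q k n] by (simp add: algebra_simps)

lemma gauss_binom_1: "gauss_binom 1 n k = of_nat (n choose k)"
  by (induction "1 :: 'a" n k rule: gauss_binom.induct) simp_all

text \<open>The exponents are natural numbers here: they are the Laurent exponents of the theorem after
  multiplication by a power of $q$.\<close>

definition gauss_binom_sum ::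
    "'a::comm_ring_1 \<Rightarrow> int \<Rightarrow> (nat \<Rightarrow> nat) \<Rightarrow> nat \<Rightarrow> nat \<Rightarrow> nat \<Rightarrow> 'a" where
  "gauss_binom_sum q s e a b n =
     (\<Sum>k<n. of_int s ^ k * q ^ e k * (\<Sum>i<2 * k + 1. q ^ i)
        * gauss_binom q (n - 1) k ^ a * gauss_binom q (n + k) k ^ b)"

section \<open>Transport along ring homomorphisms\<close>

text \<open>Serves three maps out of the integer polynomials: evaluation at a complex root of unity,
  evaluation at 1, and the embedding into the fraction field.\<close>

locale unital_ring_hom =
  fixes h :: "'a::comm_ring_1 \<Rightarrow> 'b::comm_ring_1"
  assumes h_add: "h (x + y) = h x + h y"
    and h_mult: "h (x * y) = h x * h y"
    and h_1: "h 1 = 1"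
begin

lemma h_0: "h 0 = 0"
  using h_add[of 0 0] by simp

lemma h_minus: "h (- x) = - h x"
  using h_add[of x "- x"] by (simp add: h_0 eq_neg_iff_add_eq_0 add.commute)

lemma h_power: "h (x ^ n) = h x ^ n"
  by (induction n) (simp_all add: h_1 h_mult)

lemma h_sum: "h (sum f A) = (\<Sum>x\<in>A. h (f x))"
  by (induction A rule: infinite_finite_induct) (simp_all add: h_0 h_add)

lemma h_of_int: "h (of_int s) = of_int s"
proof -
  have "h (of_nat n) = of_nat n" for n
    by (induction n) (simp_all add: h_0 h_1 h_add)
  then show ?thesis
    by (cases s rule: int_cases2) (simp_all add: h_minus)
qed

lemma h_gauss_binom: "h (gauss_binom q n k) = gauss_binom (h q) n k"
  by (induction q n k rule: gauss_binom.induct)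
    (simp_all add: h_0 h_1 h_add h_mult h_power)

lemma h_gauss_binom_sum: "h (gauss_binom_sum q s e a b n) = gauss_binom_sum (h q) s e a b n"
  by (simp only: gauss_binom_sum_def h_sum h_mult h_power h_of_int h_gauss_binom)

end

lemma unital_ring_hom_eval:
  "unital_ring_hom (\<lambda>p. poly (map_poly of_int p) (z :: 'a::comm_ring_1))"
proof
  have add: "map_poly of_int (p + q) = (map_poly of_int p + map_poly of_int q :: 'a poly)"
    for p q :: "int poly"
    by (rule poly_eqI) (simp add: coeff_map_poly)
  have smult: "map_poly of_int (smult c p) = (smult (of_int c) (map_poly of_int p) :: 'a poly)"
    for c p
    by (rule poly_eqI) (simp add: coeff_map_poly)
  have pCons: "map_poly of_int (pCons c p) = (pCons (of_int c) (map_poly of_int p) :: 'a poly)"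
    for c p
    by (rule poly_eqI) (simp add: coeff_map_poly coeff_pCons split: nat.split)
  have mult: "map_poly of_int (p * q) = (map_poly of_int p * map_poly of_int q :: 'a poly)"
    for p q :: "int poly"
    by (induction p) (simp_all add: add smult pCons)
  fix x y :: "int poly"
  show "poly (map_poly of_int (x + y)) z = poly (map_poly of_int x) z + poly (map_poly of_int y) z"
    by (simp add: add)
  show "poly (map_poly of_int (x * y)) z = poly (map_poly of_int x) z * poly (map_poly of_int y) z"
    by (simp add: mult)
  show "poly (map_poly of_int 1) z = 1"
    by simp
qed

lemma unital_ring_hom_to_fract: "unital_ring_hom to_fract"
  by standard simp_all

section \<open>Vanishing at nontrivial roots of unity\<close>

text \<open>Summation by parts: each correction term (c (k+1) - c k) * V (k+1) is zero, because
  \<open>c\<close> jumps only where \<open>V\<close> vanishes.\<close>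

lemma sum_block_telescope:
  fixes c V :: "nat \<Rightarrow> 'a::comm_ring"
  assumes "V 0 = 0" and "\<And>k. c (Suc k) = c k \<or> V (Suc k) = 0"
  shows "(\<Sum>k<Suc m. c k * (V (Suc k) - V k)) = c m * V (Suc m)"
proof (induction m)
  case 0
  then show ?case using assms(1) by simp
next
  case (Suc m)
  then show ?case using assms(2)[of m] by (auto simp: algebra_simps)
qed

context
  fixes z :: complex and a b n :: nat
  assumes n: "n > 0" and zn: "z ^ n = 1" and z1: "z \<noteq> 1"
begin

text \<open>\<open>\<Sum>{..k}\<close> is the triangular number k(k+1)/2. The exponent is
  \<open>a\<close> for both choices of a'; when a' = a - 1, the surplus factor is compensated in
  \<open>V\<close>.\<close>

definition block_coeff :: "nat \<Rightarrow> complex" where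
  "block_coeff k =
     ((- 1) ^ k * z ^ \<Sum>{..k} * gauss_binom z (n - 1) k) ^ a * gauss_binom z (n + k) k ^ b"

text \<open>By z^n = 1 both neighbour relations become multiples of 1 - z^(k+1), which may be
  cancelled: the first binomial picks up -z^-(k+1), offset by the sign and the triangular power, and
  the second does not change.\<close>

lemma block_coeff_Suc:
  assumes "z ^ Suc k \<noteq> 1"
  shows "block_coeff (Suc k) = block_coeff k"
proof -
  obtain m where m: "n = Suc m" using n gr0_implies_Suc by blast
  have "z ^ Suc k * ((1 - z ^ Suc k) * gauss_binom z m (Suc k))
          = (z ^ Suc k - 1) * gauss_binom z m k"
    using gauss_binom_step[of z k m] zn m by simp
  then have "(1 - z ^ Suc k) * (z ^ Suc k * gauss_binom z m (Suc k))
          = (1 - z ^ Suc k) * (- gauss_binom z m k)"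
    by (simp add: algebra_simps)
  with assms have A: "z ^ Suc k * gauss_binom z m (Suc k) = - gauss_binom z m k"
    by (metis mult_left_cancel right_minus_eq)
  have "z ^ Suc (n + k) = z ^ Suc k"
    using zn by (simp add: power_add)
  with gauss_binom_absorb[of z k "n + k"] assms
  have B: "gauss_binom z (n + Suc k) (Suc k) = gauss_binom z (n + k) k"
    by (metis add_Suc_right mult_left_cancel right_minus_eq)
  have "(- 1) ^ Suc k * z ^ \<Sum>{..Suc k} * gauss_binom z m (Suc k)
      = (- 1) ^ Suc k * z ^ \<Sum>{..k} * (z ^ Suc k * gauss_binom z m (Suc k))"
    by (simp add: power_add)
  also have "\<dots> = (- 1) ^ k * z ^ \<Sum>{..k} * gauss_binom z m k"
    by (simp only: A) simp
  finally show ?thesis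
    by (simp only: block_coeff_def B) (simp add: m)
qed

text \<open>Both ends of the telescope vanish: V 0 = 0 by z^0 = 1, and V n = 0 by z^n = 1.\<close>

lemma block_coeff_sum_0:
  fixes V :: "nat \<Rightarrow> complex"
  assumes "\<And>k. z ^ k = 1 \<Longrightarrow> V k = 0"
  shows "(\<Sum>k<n. block_coeff k * (V (Suc k) - V k)) = 0"
proof -
  obtain m where m: "n = Suc m" using n gr0_implies_Suc by blast
  have "(\<Sum>k<Suc m. block_coeff k * (V (Suc k) - V k)) = block_coeff m * V (Suc m)"
    by (rule sum_block_telescope) (use assms block_coeff_Suc in \<open>force+\<close>)
  with assms[of n] zn m show ?thesis by simp
qed

lemma one_minus_times_sum_powers:
  "(1 - z) * (\<Sum>i<2 * k + 1. z ^ i) = 1 - z * (z ^ k * z ^ k)"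
  using one_diff_power_eq[of z "2 * k + 1"] by (simp add: power_add mult_2)

text \<open>The case a' = a. Apart from z^N and \<open>block_coeff\<close>, the summand is z^-k (1 -
  z^(2k+1)) / (1 - z), which has to be written as a difference.\<close>

lemma gauss_binom_sum_root_of_unity_same:
  assumes "\<And>k. k < n \<Longrightarrow> e k + k = a * \<Sum>{..k} + N"
  shows "gauss_binom_sum z ((- 1) ^ a) e a b n = 0"
proof -
  have z0: "z \<noteq> 0" using n zn by (auto simp: power_0_left)
  \<comment> \<open>This is z^(1-k) (1 - z^k)^2. The constant -2z drops out of differences and makes
    \<open>V\<close> vanish whenever z^k = 1.\<close>
  define V where "V k = z * inverse z ^ k + z * z ^ k - 2 * z" for k
  let ?t = "\<lambda>k. of_int ((- 1) ^ a) ^ k * z ^ e k * (\<Sum>i<2 * k + 1. z ^ i)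
        * gauss_binom z (n - 1) k ^ a * gauss_binom z (n + k) k ^ b"
  \<comment> \<open>One factor 1 - z clears the geometric sum, the other matches the one in V (k+1)
    - V k.\<close>
  have "(1 - z) * ((1 - z) * ?t k) = z ^ N * (block_coeff k * (V (Suc k) - V k))"
    if "k < n" for k
  proof -
    have "z ^ e k * z ^ k = (z ^ \<Sum>{..k}) ^ a * z ^ N"
      using assms[OF that] by (metis power_add power_mult mult.commute)
    then have ze: "z ^ e k = inverse z ^ k * ((z ^ \<Sum>{..k}) ^ a * z ^ N)"
      using z0 by (simp add: field_simps)
    have s: "of_int ((- 1) ^ a) ^ k = (((- 1) ^ k) ^ a :: complex)"
      by (simp add: power_mult[symmetric] mult.commute)
    have V: "V (Suc k) - V k = (1 - z) * (inverse z ^ k * (1 - z * (z ^ k * z ^ k)))"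
      using z0 by (simp add: V_def field_simps)
    have "(1 - z) * ((1 - z) * ?t k) = (1 - z) * (of_int ((- 1) ^ a) ^ k * z ^ e k
        * ((1 - z) * (\<Sum>i<2 * k + 1. z ^ i))
        * gauss_binom z (n - 1) k ^ a * gauss_binom z (n + k) k ^ b)"
      by (simp only: mult_ac)
    also have "\<dots> = z ^ N * (block_coeff k * (V (Suc k) - V k))"
      unfolding one_minus_times_sum_powers V ze s block_coeff_def power_mult_distrib
      by (simp only: mult_ac)
    finally show ?thesis .
  qed
  then have "(1 - z) * ((1 - z) * gauss_binom_sum z ((- 1) ^ a) e a b n)
      = z ^ N * (\<Sum>k<n. block_coeff k * (V (Suc k) - V k))"
    by (simp add: gauss_binom_sum_def sum_distrib_left)
  also have "(\<Sum>k<n. block_coeff k * (V (Suc k) - V k)) = 0"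
    by (rule block_coeff_sum_0) (simp add: V_def power_inverse)
  finally show ?thesis using z1 by simp
qed

text \<open>The case a' = a - 1, stated additively so that a = 0 is covered. Beside
  \<open>block_coeff\<close> there now remains an extra (-1)^k z^(-k(k+1)/2).\<close>

lemma gauss_binom_sum_root_of_unity_pred:
  assumes "\<And>k. k < n \<Longrightarrow> e k + k + \<Sum>{..k} = a * \<Sum>{..k} + N"
  shows "gauss_binom_sum z (- ((- 1) ^ a)) e a b n = 0"
proof -
  have z0: "z \<noteq> 0" using n zn by (auto simp: power_0_left)
  \<comment> \<open>In V (k+1) - V k the terms without z^k or z^-k inside the bracket cancel,
    leaving z^-k - z^(k+1). No factor 1 - z arises, so one suffices below.\<close>
  define V where "V k = (- 1) ^ k * z * inverse z ^ \<Sum>{..k} * (z ^ k - 1)" for k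
  let ?t = "\<lambda>k. of_int (- ((- 1) ^ a)) ^ k * z ^ e k * (\<Sum>i<2 * k + 1. z ^ i)
        * gauss_binom z (n - 1) k ^ a * gauss_binom z (n + k) k ^ b"
  have "(1 - z) * ?t k = z ^ N * (block_coeff k * (V (Suc k) - V k))"
    if "k < n" for k
  proof -
    have "z ^ e k * (z ^ k * z ^ \<Sum>{..k}) = (z ^ \<Sum>{..k}) ^ a * z ^ N"
      using assms[OF that] by (metis power_add power_mult mult.commute add.assoc)
    then have ze: "z ^ e k
        = inverse z ^ k * inverse z ^ \<Sum>{..k} * ((z ^ \<Sum>{..k}) ^ a * z ^ N)"
      using z0 by (simp add: field_simps)
    have s: "of_int (- ((- 1) ^ a)) ^ k = ((- 1) ^ k * ((- 1) ^ k) ^ a :: complex)"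
      by (simp add: power_mult[symmetric] mult.commute power_minus[of "(- 1) ^ a"])
    have V: "V (Suc k) - V k = (- 1) ^ k *
        (inverse z ^ k * inverse z ^ \<Sum>{..k} * (1 - z * (z ^ k * z ^ k)))"
    proof -
      define T where "T = inverse z ^ \<Sum>{..k}"
      have "inverse z ^ \<Sum>{..Suc k} = T * (inverse z ^ k * inverse z)"
        by (simp add: T_def power_add)
      moreover have "T \<noteq> 0" using z0 by (simp add: T_def)
      ultimately show ?thesis
        unfolding V_def T_def[symmetric] using z0 by (simp add: field_simps)
    qed
    have "(1 - z) * ?t k = of_int (- ((- 1) ^ a)) ^ k * z ^ e k
        * ((1 - z) * (\<Sum>i<2 * k + 1. z ^ i))
        * gauss_binom z (n - 1) k ^ a * gauss_binom z (n + k) k ^ b"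
      by (simp only: mult_ac)
    also have "\<dots> = z ^ N * (block_coeff k * (V (Suc k) - V k))"
      unfolding one_minus_times_sum_powers V ze s block_coeff_def power_mult_distrib
      by (simp only: mult_ac)
    finally show ?thesis .
  qed
  then have "(1 - z) * gauss_binom_sum z (- ((- 1) ^ a)) e a b n
      = z ^ N * (\<Sum>k<n. block_coeff k * (V (Suc k) - V k))"
    by (simp add: gauss_binom_sum_def sum_distrib_left)
  also have "(\<Sum>k<n. block_coeff k * (V (Suc k) - V k)) = 0"
    by (rule block_coeff_sum_0) (simp add: V_def)
  finally show ?thesis using z1 by simp
qed

end

section \<open>From vanishing at roots of unity to divisibility\<close>

text \<open>The remainder modulo 1 + q + ... + q^(n-1) has degree below n - 1 or is zero, yet it
  vanishes at n - 1 distinct complex points.\<close>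

lemma sum_powers_dvd_if_roots_of_unity:
  fixes p :: "int poly"
  assumes "n > 0"
    and root: "\<And>z :: complex. z ^ n = 1 \<Longrightarrow> z \<noteq> 1 \<Longrightarrow> poly (map_poly of_int p) z = 0"
  shows "(\<Sum>i<n. [:0, 1:] ^ i) dvd p"
proof -
  define U :: "int poly" where "U = (\<Sum>i<n. [:0, 1:] ^ i)"
  have cU: "coeff U j = (if j < n then 1 else 0)" for j
    by (simp add: U_def coeff_sum flip: monom_altdef[of 1, simplified])
  have dU: "degree U = n - 1"
    by (rule antisym[OF degree_le le_degree]) (use \<open>n > 0\<close> in \<open>auto simp: cU\<close>)
  have U0: "U \<noteq> 0" using cU[of 0] \<open>n > 0\<close> by auto
  \<comment> \<open>\<open>U\<close> is monic, so pseudo-division scales \<open>p\<close> by 1 and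
    the quotient stays integral. For n = 1 the alternative r = 0 is the only possible one.\<close>
  obtain d r where dr: "pseudo_divmod p U = (d, r)" by fastforce
  have p: "p = U * d + r" and deg: "r = 0 \<or> degree r < n - 1"
    using pseudo_divmod[OF U0 dr] \<open>n > 0\<close> by (simp_all add: dU cU)
  define R :: "complex poly" where "R = map_poly of_int r"
  have "R = 0"
  proof (rule ccontr)
    assume "R \<noteq> 0"
    then have "degree r < n - 1" using deg by (auto simp: R_def)
    moreover have "degree R \<le> degree r" by (simp add: R_def degree_map_poly)
    moreover have "{z. z ^ n = 1} - {1} \<subseteq> {z. poly R z = 0}"
    proof safe
      fix z :: complex assume z: "z ^ n = 1" "z \<noteq> 1"
      interpret unital_ring_hom "\<lambda>p. poly (map_poly of_int p) z"
        by (rule unital_ring_hom_eval)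
      have "poly (map_poly of_int U) z = (\<Sum>i<n. z ^ i)"
        by (simp add: U_def h_sum h_power map_poly_pCons)
      also have "\<dots> = 0"
        using z one_diff_power_eq[of z n] by simp
      finally show "poly R z = 0"
        using root[OF z] h_add[of "U * d" r] h_mult[of U d] by (simp add: R_def p)
    qed
    then have "card ({z :: complex. z ^ n = 1} - {1}) \<le> card {z. poly R z = 0}"
      using \<open>R \<noteq> 0\<close> by (intro card_mono poly_roots_finite)
    moreover have "card ({z :: complex. z ^ n = 1} - {1}) = n - 1"
      using \<open>n > 0\<close> by (simp add: card_roots_unity_eq card_Diff_singleton)
    ultimately show False
      using card_poly_roots_bound[OF \<open>R \<noteq> 0\<close>] by linarith
  qed
  then have "r = 0"
    by (simp add: R_def poly_eq_iff coeff_map_poly)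
  with p show ?thesis by (simp add: U_def)
qed

text \<open>The exponent condition lives in the integers because a' may be -1. The parity of a'
  turns (-1)^(a'k) into the k-th power of one sign.\<close>

lemma gauss_binom_sum_dvd:
  assumes "n > 0" and a': "a' \<in> {int a, int a - 1}"
    and e: "\<And>k. k < n \<Longrightarrow> int (e k) = a' * int (\<Sum>{..k}) - int k + int N"
  shows "(\<Sum>i<n. [:0, 1:] ^ i) dvd
    (gauss_binom_sum [:0, 1:] (if even a' then 1 else - 1) e a b n :: int poly)"
proof (rule sum_powers_dvd_if_roots_of_unity[OF \<open>n > 0\<close>])
  fix z :: complex assume z: "z ^ n = 1" "z \<noteq> 1"
  let ?s = "if even a' then 1 else - 1 :: int"
  interpret unital_ring_hom "\<lambda>p. poly (map_poly of_int p) z"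
    by (rule unital_ring_hom_eval)
  have "gauss_binom_sum z ?s e a b n = 0"
  proof (cases "a' = int a")
    case True
    have e': "e k + k = a * \<Sum>{..k} + N" if "k < n" for k
    proof -
      have "int (e k + k) = int (a * \<Sum>{..k} + N)"
        using e[OF that] by (simp only: True of_nat_add of_nat_mult)
      then show ?thesis by (simp only: of_nat_eq_iff)
    qed
    have s: "?s = (- 1) ^ a" using True by simp
    show ?thesis
      unfolding s by (rule gauss_binom_sum_root_of_unity_same[OF \<open>n > 0\<close> z e'])
  next
    case False
    then have a': "a' = int a - 1" using a' by blast
    have e': "e k + k + \<Sum>{..k} = a * \<Sum>{..k} + N" if "k < n" for k
    proof -
      have "int (e k + k + \<Sum>{..k}) = int (a * \<Sum>{..k} + N)"
        using e[OF that] by (simp only: a' of_nat_add of_nat_mult left_diff_distrib)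
      then show ?thesis by (simp only: of_nat_eq_iff)
    qed
    have s: "?s = - ((- 1) ^ a)" using a' by simp
    show ?thesis
      unfolding s by (rule gauss_binom_sum_root_of_unity_pred[OF \<open>n > 0\<close> z e'])
  qed
  then show "poly (map_poly of_int (gauss_binom_sum [:0, 1:] ?s e a b n)) z = 0"
    by (simp only: h_gauss_binom_sum) (simp add: map_poly_pCons)
qed

section \<open>From Laurent expressions to polynomials\<close>

text \<open>The shift N = n + n(n+1)/2 is large enough, since a' >= -1 and k < n.\<close>

lemma exponent_shift:
  assumes "a' \<in> {int a, int a - 1}"
  obtains e N where
    "\<And>k. k < n \<Longrightarrow> int (e k) = a' * int (\<Sum>{..k}) - int k + int N"
proof
  fix k assume "k < n"
  have "\<Sum>{..k} \<le> \<Sum>{..n}"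
    using \<open>k < n\<close> by (intro sum_mono2) auto
  moreover have "- 1 * int (\<Sum>{..k}) \<le> a' * int (\<Sum>{..k})"
    using assms by (intro mult_right_mono) (auto simp flip: of_nat_sum)
  ultimately have "0 \<le> a' * int (\<Sum>{..k}) - int k + int (n + \<Sum>{..n})"
    using \<open>k < n\<close> by linarith
  then show "int (nat (a' * int (\<Sum>{..k}) - int k + int (n + \<Sum>{..n})))
      = a' * int (\<Sum>{..k}) - int k + int (n + \<Sum>{..n})"
    by (rule nat_0_le)
qed

interpretation to_fract: unital_ring_hom to_fract
  by (rule unital_ring_hom_to_fract)

lemma qvar_power: "qvar ^ k = to_fract ([:0, 1:] ^ k)"
  by (simp add: qvar_def to_fract.h_power)

lemma qvar_nonzero: "qvar \<noteq> 0"
  by (simp add: qvar_def)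

text \<open>Justifies cancelling 1 - q^k in the field; evaluation at 0 separates q^k from 1.\<close>

lemma qvar_power_neq_1: "k > 0 \<Longrightarrow> qvar ^ k \<noteq> 1"
proof
  assume "k > 0" "qvar ^ k = 1"
  then have "to_fract ([:0, 1 :: int:] ^ k) = to_fract 1"
    by (simp only: qvar_power to_fract_1)
  then have "[:0, 1 :: int:] ^ k = 1"
    by (simp only: to_fract_eq_iff)
  then have "poly ([:0, 1 :: int:] ^ k) 0 = 1" by simp
  with \<open>k > 0\<close> show False by (simp add: poly_power power_0_left)
qed

lemma qint_of_nat: "qint (int k) = (\<Sum>i<k. qvar ^ i)"
  using qvar_power_neq_1[of 1] by (simp add: qint_def one_diff_power_eq)

text \<open>Splitting [n] off the numerator and [k+1] off the denominator gives the absorption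
  identity of \<open>gauss_binom\<close>. For n = 0 and k > 0 the numerator contains [0] =
  0.\<close>

lemma qbinom_of_nat: "qbinom (int n) k = gauss_binom qvar n k"
proof (induction k arbitrary: n)
  case 0
  then show ?case by (simp add: qbinom_def)
next
  case (Suc k)
  show ?case
  proof (cases n)
    case 0
    have "(\<Prod>j<Suc k. qint (- int j)) = 0"
      by (rule prod_zero) (auto simp: qint_def intro!: bexI[of _ 0])
    with 0 show ?thesis by (simp add: qbinom_def del: prod.lessThan_Suc)
  next
    case (Suc m)
    have "(\<Prod>j<Suc k. qint (int n - int j)) = qint (int n) * (\<Prod>j<k. qint (int m - int j))"
      by (simp add: prod.lessThan_Suc_shift Suc del: prod.lessThan_Suc)
    then have "qbinom (int n) (Suc k) = qint (int n) / qint (int (Suc k)) * qbinom (int m) k"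
      by (simp add: qbinom_def mult_ac)
    also have "\<dots> = (1 - qvar ^ Suc m) * gauss_binom qvar m k / (1 - qvar ^ Suc k)"
      using qvar_power_neq_1[of 1]
      by (simp only: Suc Suc.IH qint_def power_int_of_nat) simp
    also have "\<dots> = gauss_binom qvar n (Suc k)"
      using qvar_power_neq_1[of "Suc k"]
      by (simp only: Suc flip: gauss_binom_absorb) simp
    finally show ?thesis .
  qed
qed

lemma q_sum_eq_gauss_binom_sum:
  assumes "n > 0"
    and e: "\<And>k. k < n \<Longrightarrow> int (e k) = a' * int (\<Sum>{..k}) - int k + int N"
  shows "(\<Sum>k = 0..n - 1. (- 1) powi (a' * int k)
             * qvar powi (a' * int k * (int k + 1) div 2 - int k)
             * qint (2 * int k + 1)
             * qbinom (int n - 1) k ^ a * qbinom (int n + int k) k ^ b)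
     = gauss_binom_sum qvar (if even a' then 1 else - 1) e a b n * qvar powi (- int N)"
proof -
  have range: "{0..n - 1} = {..<n}" using \<open>n > 0\<close> by auto
  show ?thesis
    unfolding gauss_binom_sum_def range sum_distrib_right
  proof (rule sum.cong[OF refl])
    fix k assume "k \<in> {..<n}"
    then have k: "k < n" by simp
    \<comment> \<open>Exhibiting the factor 2 makes the integer division exact, also for negative
      a'.\<close>
    have "a' * int k * (int k + 1) = 2 * (a' * int (\<Sum>{..k}))"
      using double_gauss_sum[of k, where ?'a = int]
      by (simp add: atMost_atLeast0 algebra_simps)
    then have "a' * int k * (int k + 1) div 2 = a' * int (\<Sum>{..k})"
      by (simp only: nonzero_mult_div_cancel_left)
    then have "a' * int k * (int k + 1) div 2 - int k = int (e k) + - int N"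
      using e[OF k] by linarith
    then have "qvar powi (a' * int k * (int k + 1) div 2 - int k)
        = qvar ^ e k * qvar powi (- int N)"
      by (simp only: power_int_add[OF disjI1[OF qvar_nonzero]] power_int_of_nat)
    moreover have "(- 1 :: int poly fract) powi (a' * int k)
        = of_int (if even a' then 1 else - 1) ^ k"
      by (simp add: power_int_mult power_int_minus_left)
    moreover have "qint (2 * int k + 1) = (\<Sum>i<2 * k + 1. qvar ^ i)"
      using qint_of_nat[of "2 * k + 1"] by (simp add: add.commute)
    moreover have "qbinom (int n - 1) k = gauss_binom qvar (n - 1) k"
      using qbinom_of_nat[of "n - 1" k] \<open>n > 0\<close> by simp
    moreover have "qbinom (int n + int k) k = gauss_binom qvar (n + k) k"
      using qbinom_of_nat[of "n + k" k] by simp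
    ultimately show "(- 1) powi (a' * int k)
             * qvar powi (a' * int k * (int k + 1) div 2 - int k)
             * qint (2 * int k + 1)
             * qbinom (int n - 1) k ^ a * qbinom (int n + int k) k ^ b
        = of_int (if even a' then 1 else - 1) ^ k * qvar ^ e k * (\<Sum>i<2 * k + 1. qvar ^ i)
          * gauss_binom qvar (n - 1) k ^ a * gauss_binom qvar (n + k) k ^ b
          * qvar powi (- int N)"
      by (simp only: mult_ac)
  qed
qed

section \<open>The q-congruence and its value at q = 1\<close>

theorem theorem3p2:
  fixes a b n :: nat
  assumes "n > 0"
  shows "(\<forall>a' \<in> {int a, int a - 1}.
            laurent_cong
              (\<Sum>k = 0..n - 1. (- 1) powi (a' * int k)
                 * qvar powi (a' * int k * (int k + 1) div 2 - int k)
                 * qint (2 * int k + 1)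
                 * qbinom (int n - 1) k ^ a * qbinom (int n + int k) k ^ b)
              0 (qint (int n)))
       \<and> (\<forall>s \<in> {1, - 1 :: int}.
            [(\<Sum>k = 0..n - 1. s ^ k * (2 * int k + 1)
                 * int ((n - 1) choose k) ^ a * int ((n + k) choose k) ^ b) = 0] (mod int n))"
proof (intro conjI ballI)
  fix a' assume a': "a' \<in> {int a, int a - 1}"
  obtain e N where e: "\<And>k. k < n \<Longrightarrow> int (e k) = a' * int (\<Sum>{..k}) - int k + int N"
    using exponent_shift[OF a'] by metis
  let ?s = "if even a' then 1 else - 1 :: int"
  \<comment> \<open>The cofactor is found among integer polynomials, before passing to the field;
    times q^-N it is the required Laurent cofactor.\<close>
  obtain w :: "int poly" where
    w: "gauss_binom_sum [:0, 1:] ?s e a b n = (\<Sum>i<n. [:0, 1:] ^ i) * w"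
    using gauss_binom_sum_dvd[OF assms a' e] by blast
  have P: "gauss_binom_sum qvar ?s e a b n = to_fract (gauss_binom_sum [:0, 1:] ?s e a b n)"
    by (simp only: to_fract.h_gauss_binom_sum qvar_def)
  have U: "qint (int n) = to_fract (\<Sum>i<n. [:0, 1:] ^ i)"
    by (simp only: qint_of_nat to_fract.h_sum qvar_power)
  have mem: "to_fract p * qvar powi i \<in> laurent_polys" for p i
    unfolding laurent_polys_def by blast
  have mem': "to_fract p \<in> laurent_polys" for p
    using mem[of p 0] by simp
  have mem0: "0 \<in> laurent_polys"
    using mem'[of 0] by simp
  let ?S = "\<Sum>k = 0..n - 1. (- 1) powi (a' * int k)
                 * qvar powi (a' * int k * (int k + 1) div 2 - int k)
                 * qint (2 * int k + 1)
                 * qbinom (int n - 1) k ^ a * qbinom (int n + int k) k ^ b"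
  have "?S = to_fract (gauss_binom_sum [:0, 1:] ?s e a b n) * qvar powi (- int N)"
    using q_sum_eq_gauss_binom_sum[OF assms e] by (simp only: P)
  then have S: "?S = to_fract ((\<Sum>i<n. [:0, 1:] ^ i) * w) * qvar powi (- int N)"
    by (simp only: w)
  have "?S - 0 = qint (int n) * (to_fract w * qvar powi (- int N))"
    unfolding S U by (simp only: to_fract_mult diff_zero mult.assoc)
  moreover have "?S \<in> laurent_polys" "qint (int n) \<in> laurent_polys"
    unfolding S U by (rule mem mem')+
  ultimately show "laurent_cong ?S 0 (qint (int n))"
    unfolding laurent_cong_def using mem mem0 by blast
next
  fix s :: int assume s: "s \<in> {1, - 1}"
  \<comment> \<open>Consecutive integers have opposite parity, so both signs occur.\<close>
  have "\<exists>a' \<in> {int a, int a - 1}. s = (if even a' then 1 else - 1)"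
    using s by auto
  then obtain a' where a': "a' \<in> {int a, int a - 1}"
    and sa': "s = (if even a' then 1 else - 1)" by blast
  obtain e N where e: "\<And>k. k < n \<Longrightarrow> int (e k) = a' * int (\<Sum>{..k}) - int k + int N"
    using exponent_shift[OF a'] by metis
  obtain w :: "int poly" where
    w: "gauss_binom_sum [:0, 1:] s e a b n = (\<Sum>i<n. [:0, 1:] ^ i) * w"
    using gauss_binom_sum_dvd[OF assms a' e] unfolding sa' by blast
  \<comment> \<open>At q = 1 the exponents disappear, the Gaussian binomials become ordinary ones,
    and 1 + q + ... + q^(n-1) becomes n.\<close>
  interpret unital_ring_hom "\<lambda>p. poly (map_poly of_int p) (1 :: int)"
    by (rule unital_ring_hom_eval)
  have range: "{0..n - 1} = {..<n}" using \<open>n > 0\<close> by auto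
  have "(\<Sum>k = 0..n - 1. s ^ k * (2 * int k + 1)
                 * int ((n - 1) choose k) ^ a * int ((n + k) choose k) ^ b)
      = gauss_binom_sum 1 s e a b n"
    unfolding gauss_binom_sum_def range by (simp add: gauss_binom_1 algebra_simps)
  also have "\<dots> = poly (map_poly of_int (gauss_binom_sum [:0, 1:] s e a b n)) 1"
    by (simp only: h_gauss_binom_sum) (simp add: map_poly_pCons)
  also have "\<dots> = int n * poly (map_poly of_int w) 1"
    by (simp only: w h_mult h_sum h_power) (simp add: map_poly_pCons)
  finally show "[(\<Sum>k = 0..n - 1. s ^ k * (2 * int k + 1)
                 * int ((n - 1) choose k) ^ a * int ((n + k) choose k) ^ b) = 0] (mod int n)"
    by (simp add: cong_0_iff)
qed

end
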